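(* Let $(S_k,X_k)_{k\ge0}$ be an $\mathbb{S}\times\mathbb{X}$-valued process adapted to a filtration $(\mathcal{F}_k)_{k\ge0}$ such that $\mathbb{P}(X_{k+1}\in A\mid\mathcal{F}_k)=P_{S_k}(X_k,A)$ a.s. for all $k\ge0$ and measurable $A\subset\mathbb{X}$. Suppose there exist constants $C<\infty$ and $\rho\in[0,1)$ such that $d_{\mathrm{tv}}(P_s^k(x,\cdot),\pi)\le C\rho^k$ for all $x\in\mathbb{X}$, $s\in\mathbb{S}$, $k\ge0$. Let $C_k=\{S_k\ne S_{k-1}\}$ for $k\ge1$, and define the adaptation times $\tau_1=\inf\{k\ge1: C_k\text{ occurs}\}$ and $\tau_j=\inf\{k>\tau_{j-1}: C_k\text{ occurs}\}$ for $j\ge2$, with $\tau_j=\infty$ if $\tau_{j-1}=\infty$ or if no such $k$ exists. Suppose that one of the following holds: $$\sum_{k=1}^\infty\frac{\mathbb{P}(C_k)}{k}<\infty\qquad\text{or}\qquad\sum_{j=1}^\infty\mathbb{E}\big[\tau_j^{-1}\big]<\infty .$$ Then, for any bounded measurable $\varphi:\mathbb{X}\to\mathbb{R}$, $$\frac1n\sum_{k=1}^n\varphi(X_k)\xrightarrow{n\to\infty}\pi(\varphi)\quad\text{almost surely.}$$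
   Context: $(\mathbb{X},\mathcal{X})$ and $(\mathbb{S},\mathcal{S})$ are measurable spaces. $\pi$ is a probability measure on $\mathbb{X}$ and $\{P_s\}_{s\in\mathbb{S}}$ is a family of Markov transition probabilities on $\mathbb{X}$, each $\pi$-invariant, such that $(s,x)\mapsto P_s(x,A)$ is $\mathcal{S}\otimes\mathcal{X}$-measurable for all $A\in\mathcal{X}$. The sets $\{S_k\ne S_{k-1}\}$ are events (measurable), and $\infty^{-1}=0$. Notation: $\pi(f)=\int f\,d\pi$; $P^k$ is the $k$-step transition, $P^0$ the identity, $\rho^0=1$; $d_{\mathrm{tv}}(\mu,\nu)=\sup_A|\mu(A)-\nu(A)|$. *)

theory Defs
  imports "HOL-Probability.Probability"
begin

definition markov_kernel :: "'x measure \<Rightarrow> ('x \<Rightarrow> 'x measure) \<Rightarrow> bool" where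
  "markov_kernel X K \<longleftrightarrow> K \<in> X \<rightarrow>\<^sub>M prob_algebra X"

definition invariant_measure :: "'x measure \<Rightarrow> ('x \<Rightarrow> 'x measure) \<Rightarrow> bool" where
  "invariant_measure \<pi> K \<longleftrightarrow> \<pi> \<bind> K = \<pi>"

primrec kernel_power :: "'x measure \<Rightarrow> ('x \<Rightarrow> 'x measure) \<Rightarrow> nat \<Rightarrow> 'x \<Rightarrow> 'x measure" where
  "kernel_power X K 0 x = return X x"
| "kernel_power X K (Suc n) x = kernel_power X K n x \<bind> K"

text \<open>Only meaningful for finite measures with the same \<open>\<sigma>\<close>-algebra: the supremum is
  taken in the reals, hence needs a bounded family.\<close>
definition tv_dist :: "'x measure \<Rightarrow> 'x measure \<Rightarrow> real" where
  "tv_dist \<mu> \<nu> = (SUP A\<in>sets \<mu>. \<bar>measure \<mu> A - measure \<nu> A\<bar>)"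

text \<open>Used for indices \<open>k \<ge> 1\<close> only; \<open>adapt_event M S 0\<close> is empty.\<close>
definition adapt_event :: "'a measure \<Rightarrow> (nat \<Rightarrow> 'a \<Rightarrow> 's) \<Rightarrow> nat \<Rightarrow> 'a set" where
  "adapt_event M S k = {\<omega> \<in> space M. S k \<omega> \<noteq> S (k - 1) \<omega>}"

text \<open>The value 0 at index 0 is a convention that makes the first adaptation time (index 1) the
  infimum over \<open>k \<ge> 1\<close>. In \<^typ>\<open>enat\<close> the infimum of the empty set is \<open>\<infinity>\<close>, which also covers
  the case that the previous time is \<open>\<infinity>\<close>.\<close>
primrec adapt_time :: "(nat \<Rightarrow> 'a set) \<Rightarrow> nat \<Rightarrow> 'a \<Rightarrow> enat" where
  "adapt_time C 0 \<omega> = 0"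
| "adapt_time C (Suc j) \<omega> = Inf {enat k |k. adapt_time C j \<omega> < enat k \<and> \<omega> \<in> C k}"

lemma kernel_power_measurable:
  assumes "markov_kernel X K"
  shows "kernel_power X K n \<in> X \<rightarrow>\<^sub>M prob_algebra X"
proof (induction n)
  case 0
  have "kernel_power X K 0 = return X" by (rule ext) simp
  then show ?case by (simp add: measurable_return_prob_space)
next
  case (Suc n)
  have "(\<lambda>x. kernel_power X K n x \<bind> K) \<in> X \<rightarrow>\<^sub>M prob_algebra X"
    using Suc assms unfolding markov_kernel_def by (rule measurable_bind_prob_space)
  moreover have "kernel_power X K (Suc n) = (\<lambda>x. kernel_power X K n x \<bind> K)" by (rule ext) simp
  ultimately show ?case by simp
qed

lemma emeasure_kernel_power_Suc:
  assumes K: "markov_kernel X K" and x: "x \<in> space X" and A: "A \<in> sets X"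
  shows "emeasure (kernel_power X K (Suc n) x) A = (\<integral>\<^sup>+ y. emeasure (K y) A \<partial>kernel_power X K n x)"
proof -
  have sp: "kernel_power X K n x \<in> space (prob_algebra X)"
    using measurable_space[OF kernel_power_measurable[OF K] x] .
  then have s: "sets (kernel_power X K n x) = sets X" by (simp add: space_prob_algebra)
  have "space X \<noteq> {}" using x by auto
  moreover have "space (kernel_power X K n x) = space X" using sets_eq_imp_space_eq[OF s] .
  moreover have "K \<in> kernel_power X K n x \<rightarrow>\<^sub>M subprob_algebra X"
    using measurable_prob_algebraD[OF K[unfolded markov_kernel_def]]
    by (simp cong: measurable_cong_sets add: s)
  ultimately show ?thesis using A by (simp add: emeasure_bind)
qed

lemma adapt_time_1: "adapt_time C 1 \<omega> = Inf {enat k |k. 1 \<le> k \<and> \<omega> \<in> C k}"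
  by (simp add: zero_enat_def Suc_le_eq)

end

theory Submission
  imports Defs "HOL-Library.Discrete_Functions"
begin

text \<open>Let \<open>g\<^sub>s\<close> be the solution \<open>\<Sum>i. (P\<^sub>s\<^sup>i \<phi> - \<pi>(\<phi>))\<close> of the Poisson equation of \<open>P\<^sub>s\<close>; geometric
  ergodicity bounds it uniformly in \<open>s\<close>. Then \<open>\<phi>(X\<^sub>k) - \<pi>(\<phi>)\<close> is the sum of the bounded
  martingale difference \<open>g(S\<^sub>k, X\<^sub>k\<^sub>+\<^sub>1) - (P g)(S\<^sub>k, X\<^sub>k)\<close>, which averages out by the strong law for
  bounded orthogonal variables, and of \<open>g(S\<^sub>k, X\<^sub>k) - g(S\<^sub>k, X\<^sub>k\<^sub>+\<^sub>1)\<close>, which telescopes except for a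
  bounded error at each adaptation. Both summability hypotheses make
  \<open>\<Sum>k. 1\<^sub>C\<^sub>k / k\<close> finite almost surely (every adaptation is some \<open>\<tau>\<^sub>j\<close>), so by Kronecker's lemma
  the proportion of adaptations tends to 0.\<close>

section \<open>Averages of sequences and of bounded orthogonal variables\<close>

text \<open>The terms before \<open>N\<close> contribute a constant, which dies after division by
  \<open>n\<close>; every later term deviates from \<open>L\<close> by less than
  \<open>e / 2\<close>.\<close>

lemma cesaro_tendsto:
  fixes u :: "nat \<Rightarrow> real"
  assumes "u \<longlonglongrightarrow> L"
  shows "(\<lambda>n. (\<Sum>k<n. u k) / real n) \<longlonglongrightarrow> L"
proof (rule LIMSEQ_I)
  fix e :: real assume "0 < e"
  then obtain N where N: "\<And>n. n \<ge> N \<Longrightarrow> \<bar>u n - L\<bar> < e / 2"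
    using LIMSEQ_D[OF assms, of "e / 2"] by auto
  define c where "c = (\<Sum>k<N. \<bar>u k - L\<bar>)"
  have "(\<lambda>n. c / real n) \<longlonglongrightarrow> 0" by (rule lim_const_over_n)
  then obtain N' where N': "\<And>n. n \<ge> N' \<Longrightarrow> \<bar>c / real n\<bar> < e / 2"
    using \<open>0 < e\<close> LIMSEQ_D[of _ 0 "e / 2"] by fastforce
  show "\<exists>n0. \<forall>n\<ge>n0. norm ((\<Sum>k<n. u k) / real n - L) < e"
  \<comment> \<open>\<open>Suc N\<close> instead of \<open>N\<close> ensures that \<open>n\<close>
    is positive, so that division by \<open>n\<close> is harmless.\<close>
  proof (intro exI[of _ "max (Suc N) N'"] allI impI)
    fix n assume "n \<ge> max (Suc N) N'"
    then have n: "n \<ge> N" "n > 0" "n \<ge> N'" by auto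
    have "(\<Sum>k<n. u k) / real n - L = (\<Sum>k<n. u k - L) / real n"
      using n by (simp add: sum_subtractf field_simps)
    moreover have "\<bar>\<Sum>k<n. u k - L\<bar> \<le> (\<Sum>k<n. \<bar>u k - L\<bar>)" by (rule sum_abs)
    moreover have "(\<Sum>k<n. \<bar>u k - L\<bar>) = c + (\<Sum>k=N..<n. \<bar>u k - L\<bar>)"
      using n unfolding c_def lessThan_atLeast0 by (simp add: sum.atLeastLessThan_concat)
    moreover have "(\<Sum>k=N..<n. \<bar>u k - L\<bar>) \<le> (\<Sum>k=N..<n. e / 2)"
      using N by (intro sum_mono) (auto intro: less_imp_le)
    moreover have "(\<Sum>k=N..<n. e / 2) \<le> real n * (e / 2)"
      using \<open>0 < e\<close> by (simp add: mult_right_mono)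
    ultimately have "\<bar>(\<Sum>k<n. u k) / real n - L\<bar> \<le> (c + real n * (e / 2)) / real n"
      using n by (simp add: abs_divide divide_right_mono)
    also have "\<dots> = c / real n + e / 2" using n by (simp add: field_simps)
    also have "\<dots> < e" using N'[OF n(3)] abs_ge_self[of "c / real n"] by linarith
    finally show "norm ((\<Sum>k<n. u k) / real n - L) < e" by simp
  qed
qed

text \<open>Summation by parts writes the sum of \<open>a\<close> as \<open>n\<close> times the
  partial sum \<open>T n\<close> minus the sum of all earlier \<open>T k\<close>. After division by
  \<open>n\<close>, both pieces tend to the limit of the series and cancel.\<close>

lemma kronecker_div_of_nat:
  fixes a :: "nat \<Rightarrow> real"
  assumes "summable (\<lambda>k. a k / real (Suc k))"
  shows "(\<lambda>n. (\<Sum>k<n. a k) / real n) \<longlonglongrightarrow> 0"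
proof -
  define T where "T n = (\<Sum>k<n. a k / real (Suc k))" for n
  from assms obtain L where L: "T \<longlonglongrightarrow> L"
    unfolding T_def summable_def sums_def by blast
  have parts: "(\<Sum>k<n. a k) = real n * T n - (\<Sum>k<n. T k)" for n
  proof (induction n)
    case (Suc n)
    have "T (Suc n) = T n + a n / real (Suc n)" by (simp add: T_def)
    then have "real (Suc n) * T (Suc n) = real (Suc n) * T n + a n"
      by (simp add: field_simps)
    then show ?case using Suc by (simp add: algebra_simps)
  qed simp
  have "(\<lambda>n. T n - (\<Sum>k<n. T k) / real n) \<longlonglongrightarrow> L - L"
    by (intro tendsto_diff L cesaro_tendsto)
  moreover have "\<forall>\<^sub>F n in sequentially. T n - (\<Sum>k<n. T k) / real n = (\<Sum>k<n. a k) / real n"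
    using eventually_gt_at_top[of 0] by eventually_elim (simp add: parts field_simps)
  ultimately show ?thesis by (simp add: tendsto_cong)
qed

text \<open>Between two consecutive squares there are only of order \<open>m\<close> indices, where
  \<open>m\<close> is the integer square root of \<open>n\<close>. Bounded terms there contribute
  order \<open>m\<close>, negligible against \<open>m^2\<close>.\<close>

lemma average_tendsto_0_of_squares:
  fixes a :: "nat \<Rightarrow> real"
  assumes bound: "\<And>k. \<bar>a k\<bar> \<le> c"
    and squares: "(\<lambda>n. (\<Sum>k<n\<^sup>2. a k) / real (n\<^sup>2)) \<longlonglongrightarrow> 0"
  shows "(\<lambda>n. (\<Sum>k<n. a k) / real n) \<longlonglongrightarrow> 0"
proof -
  define m :: "nat \<Rightarrow> nat" where "m = floor_sqrt"
  have c: "0 \<le> c" using bound[of 0] by simp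
  have m_top: "filterlim m at_top sequentially"
    unfolding filterlim_at_top m_def
  proof
    fix Z :: nat
    show "\<forall>\<^sub>F n in sequentially. Z \<le> floor_sqrt n"
      using eventually_ge_at_top[of "Z\<^sup>2"] by eventually_elim (rule le_floor_sqrtI)
  qed
  \<comment> \<open>The dominating sequence is indexed by the root \<open>k\<close>: the average at
    \<open>k^2\<close>, plus the gap contribution \<open>3 k c / k^2\<close>.\<close>
  define b where "b k = \<bar>(\<Sum>i<k\<^sup>2. a i) / real (k\<^sup>2)\<bar> + 3 * c * inverse (real k)" for k
  have "b \<longlonglongrightarrow> \<bar>0\<bar> + 3 * c * 0"
    unfolding b_def by (intro tendsto_intros squares lim_inverse_n)
  then have "(\<lambda>n. b (m n)) \<longlonglongrightarrow> 0"
    using filterlim_compose[OF _ m_top] by simp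
  moreover have "\<forall>\<^sub>F n in sequentially. norm ((\<Sum>k<n. a k) / real n) \<le> b (m n)"
    using eventually_gt_at_top[of 0]
  proof eventually_elim
    case (elim n)
    have m: "0 < m n" "(m n)\<^sup>2 \<le> n" "n < (Suc (m n))\<^sup>2"
      using elim Suc_floor_sqrt_power2_gt[of n] by (auto simp: m_def)
    have "real n < (real (m n) + 1)\<^sup>2"
      using m(3) by (metis of_nat_Suc of_nat_less_iff of_nat_power add.commute)
    \<comment> \<open>The gap is below \<open>2 m + 1\<close>; since \<open>m\<close> is at least 1,
      \<open>3 m\<close> bounds it and keeps the estimate proportional to \<open>m\<close>.\<close>
    then have gap: "real n - (real (m n))\<^sup>2 \<le> 3 * real (m n)"
      using m(1) by (simp add: power2_eq_square algebra_simps)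
    have split: "(\<Sum>k<n. a k) = (\<Sum>k<(m n)\<^sup>2. a k) + (\<Sum>k=(m n)\<^sup>2..<n. a k)"
      using m(2) unfolding lessThan_atLeast0 by (simp add: sum.atLeastLessThan_concat)
    have "\<bar>\<Sum>k=(m n)\<^sup>2..<n. a k\<bar> \<le> (\<Sum>k=(m n)\<^sup>2..<n. c)"
      using bound by (intro order_trans[OF sum_abs] sum_mono)
    also have "\<dots> = (real n - (real (m n))\<^sup>2) * c"
      using m(2) by (simp add: of_nat_diff)
    also have "\<dots> \<le> 3 * real (m n) * c" by (rule mult_right_mono[OF gap c])
    finally have "\<bar>\<Sum>k<n. a k\<bar> \<le> \<bar>\<Sum>k<(m n)\<^sup>2. a k\<bar> + 3 * real (m n) * c"
      unfolding split by linarith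
    then have "\<bar>\<Sum>k<n. a k\<bar> / real n \<le> (\<bar>\<Sum>k<(m n)\<^sup>2. a k\<bar> + 3 * real (m n) * c) / real n"
      by (rule divide_right_mono) simp
    also have "\<dots> \<le> (\<bar>\<Sum>k<(m n)\<^sup>2. a k\<bar> + 3 * real (m n) * c) / real ((m n)\<^sup>2)"
      using m c elim by (intro divide_left_mono) (auto intro!: mult_pos_pos simp del: of_nat_power)
    also have "\<dots> = b (m n)"
    proof -
      have "3 * real (m n) * c / real ((m n)\<^sup>2) = 3 * c * inverse (real (m n))"
        using m(1) by (simp add: power2_eq_square divide_inverse)
      then show ?thesis by (simp add: b_def add_divide_distrib)
    qed
    finally show ?case by (simp add: abs_divide)
  qed
  ultimately show ?thesis by (rule Lim_null_comparison[rotated])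
qed

text \<open>Along the squares the second moments of the averages are summable; the boundedness of the
  increments controls the gaps between consecutive squares, so no maximal inequality is needed.\<close>
lemma (in prob_space) strong_law_bounded_orthogonal:
  fixes d :: "nat \<Rightarrow> 'a \<Rightarrow> real"
  assumes meas [measurable]: "\<And>k. d k \<in> borel_measurable M"
    and bound: "\<And>k \<omega>. \<omega> \<in> space M \<Longrightarrow> \<bar>d k \<omega>\<bar> \<le> c"
    and orth: "\<And>j k. j < k \<Longrightarrow> expectation (\<lambda>\<omega>. d j \<omega> * d k \<omega>) = 0"
  shows "AE \<omega> in M. (\<lambda>n. (\<Sum>k<n. d k \<omega>) / real n) \<longlonglongrightarrow> 0"
proof -
  obtain \<omega>0 where "\<omega>0 \<in> space M" using not_empty by auto
  then have c: "0 \<le> c" using bound[of \<omega>0 0] by simp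
  define T where "T n \<omega> = (\<Sum>k<n. d k \<omega>)" for n \<omega>
  have T_meas [measurable]: "T n \<in> borel_measurable M" for n unfolding T_def by measurable
  have T_bound: "\<bar>T n \<omega>\<bar> \<le> real n * c" if "\<omega> \<in> space M" for n \<omega>
  proof -
    have "\<bar>T n \<omega>\<bar> \<le> (\<Sum>k<n. c)"
      unfolding T_def using bound[OF that] by (intro order_trans[OF sum_abs] sum_mono)
    then show ?thesis by simp
  qed
  have prod_int: "integrable M (\<lambda>\<omega>. d j \<omega> * d k \<omega>)" for j k
    by (rule integrable_const_bound[of _ "c * c"])
       (auto intro!: AE_I2 mult_mono bound c simp: abs_mult)
  have T_d: "expectation (\<lambda>\<omega>. T n \<omega> * d n \<omega>) = 0" for n
  proof -
    have "expectation (\<lambda>\<omega>. T n \<omega> * d n \<omega>) = (\<Sum>j<n. expectation (\<lambda>\<omega>. d j \<omega> * d n \<omega>))"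
      unfolding T_def sum_distrib_right by (rule Bochner_Integration.integral_sum) (rule prod_int)
    then show ?thesis using orth by simp
  qed
  have T_d_int: "integrable M (\<lambda>\<omega>. T n \<omega> * d n \<omega>)" for n
    unfolding T_def sum_distrib_right by (intro Bochner_Integration.integrable_sum prod_int)
  have T_sq_int: "integrable M (\<lambda>\<omega>. (T n \<omega>)\<^sup>2)" for n
    by (rule integrable_const_bound[of _ "(real n * c)\<^sup>2"])
       (auto intro!: AE_I2 power2_le_iff_abs_le[THEN iffD2] T_bound c mult_nonneg_nonneg)
  \<comment> \<open>Since the cross term \<open>T n * d n\<close> has mean 0, each new term adds at
    most \<open>c^2\<close>: the second moment grows linearly instead of quadratically.\<close>
  have second_moment: "expectation (\<lambda>\<omega>. (T n \<omega>)\<^sup>2) \<le> real n * c\<^sup>2" for n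
  proof (induction n)
    case 0 then show ?case by (simp add: T_def)
  next
    case (Suc n)
    have d_sq: "expectation (\<lambda>\<omega>. d n \<omega> * d n \<omega>) \<le> expectation (\<lambda>\<omega>. c\<^sup>2)"
      using bound c by (intro integral_mono prod_int integrable_const)
        (auto simp: power2_eq_square[symmetric] power2_le_iff_abs_le)
    have "(\<lambda>\<omega>. (T (Suc n) \<omega>)\<^sup>2) = (\<lambda>\<omega>. (T n \<omega>)\<^sup>2 + 2 * (T n \<omega> * d n \<omega>) + d n \<omega> * d n \<omega>)"
      by (auto simp: T_def power2_eq_square algebra_simps)
    then have "expectation (\<lambda>\<omega>. (T (Suc n) \<omega>)\<^sup>2)
        = expectation (\<lambda>\<omega>. (T n \<omega>)\<^sup>2) + 2 * expectation (\<lambda>\<omega>. T n \<omega> * d n \<omega>) + expectation (\<lambda>\<omega>. d n \<omega> * d n \<omega>)"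
      by (simp add: T_sq_int T_d_int prod_int)
    also have "\<dots> \<le> real n * c\<^sup>2 + c\<^sup>2" using Suc T_d d_sq by (simp add: prob_space)
    finally show ?case by (simp add: algebra_simps)
  qed
  define Y where "Y n \<omega> = (T (n\<^sup>2) \<omega> / real (n\<^sup>2))\<^sup>2" for n \<omega>
  have Y_meas [measurable]: "Y n \<in> borel_measurable M" for n unfolding Y_def by measurable
  \<comment> \<open>Linear growth at time \<open>n^2\<close> divided by \<open>n^4\<close> leaves
    \<open>c^2 / n^2\<close>, which is summable. At \<open>n = 0\<close> both sides are 0 because
    division by zero yields 0.\<close>
  have Y_int: "(\<integral>\<^sup>+\<omega>. ennreal (Y n \<omega>) \<partial>M) \<le> ennreal (c\<^sup>2 * (1 / real n ^ 2))" for n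
  proof (cases "n = 0")
    case False
    have "(\<integral>\<^sup>+\<omega>. ennreal (Y n \<omega>) \<partial>M) = ennreal (expectation (\<lambda>\<omega>. (T (n\<^sup>2) \<omega>)\<^sup>2 / (real (n\<^sup>2))\<^sup>2))"
      unfolding Y_def power_divide by (intro nn_integral_eq_integral integrable_divide T_sq_int) auto
    also have "\<dots> = ennreal (expectation (\<lambda>\<omega>. (T (n\<^sup>2) \<omega>)\<^sup>2) / (real (n\<^sup>2))\<^sup>2)"
      by (simp only: integral_divide_zero)
    also have "\<dots> \<le> ennreal (real (n\<^sup>2) * c\<^sup>2 / (real (n\<^sup>2))\<^sup>2)"
      by (intro ennreal_leI divide_right_mono second_moment) auto
    also have "real (n\<^sup>2) * c\<^sup>2 / (real (n\<^sup>2))\<^sup>2 = c\<^sup>2 * (1 / real n ^ 2)"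
      using False by (simp add: power2_eq_square)
    finally show ?thesis .
  qed (simp add: Y_def)
  \<comment> \<open>Borel-Cantelli in integral form: a series of nonnegative variables with finite
    expectation converges almost surely, so its terms tend to 0.\<close>
  have "(\<integral>\<^sup>+\<omega>. (\<Sum>n. ennreal (Y n \<omega>)) \<partial>M) = (\<Sum>n. \<integral>\<^sup>+\<omega>. ennreal (Y n \<omega>) \<partial>M)"
    by (rule nn_integral_suminf) measurable
  also have "\<dots> \<le> (\<Sum>n. ennreal (c\<^sup>2 * (1 / real n ^ 2)))"
    by (intro suminf_le Y_int) auto
  also have "\<dots> < \<infinity>"
  proof (subst suminf_ennreal2)
    show "summable (\<lambda>n. c\<^sup>2 * (1 / real n ^ 2))"
      using inverse_power_summable[of 2, where 'a = real]
      by (intro summable_mult) (simp add: inverse_eq_divide)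
  qed auto
  finally have "AE \<omega> in M. (\<Sum>n. ennreal (Y n \<omega>)) \<noteq> \<infinity>"
    by (intro nn_integral_PInf_AE) auto
  then show ?thesis
    using AE_space
  proof eventually_elim
    case (elim \<omega>)
    have "summable (\<lambda>n. Y n \<omega>)"
      using elim(1) by (intro summable_suminf_not_top) (auto simp: Y_def)
    then have "(\<lambda>n. Y n \<omega>) \<longlonglongrightarrow> 0" by (rule summable_LIMSEQ_zero)
    then have "(\<lambda>n. sqrt (Y n \<omega>)) \<longlonglongrightarrow> sqrt 0" by (rule tendsto_real_sqrt)
    then have "(\<lambda>n. T (n\<^sup>2) \<omega> / real (n\<^sup>2)) \<longlonglongrightarrow> 0"
      unfolding Y_def real_sqrt_abs real_sqrt_zero by (rule tendsto_rabs_zero_cancel)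
    then show ?case
      using bound[OF elim(2)] unfolding T_def by (intro average_tendsto_0_of_squares)
  qed
qed

section \<open>Adaptation times\<close>

text \<open>Strong induction on \<open>k\<close>: the last adaptation \<open>i\<close> before
  \<open>k\<close>, or 0 if there is none, is already some adaptation time, and \<open>k\<close> is
  then the next one.\<close>

lemma adapt_time_hits:
  assumes "\<omega> \<in> C k" "1 \<le> k"
  shows "\<exists>j. adapt_time C (Suc j) \<omega> = enat k"
  using assms
proof (induction k rule: less_induct)
  case (less k)
  \<comment> \<open>Admitting \<open>i = 0\<close> unconditionally matches the convention that the
    adaptation time of index 0 is 0, and makes a greatest element exist.\<close>
  define Q where "Q i \<longleftrightarrow> i < k \<and> (i = 0 \<or> \<omega> \<in> C i)" for i
  define i where "i = Greatest Q"
  have Q_less: "l \<le> k" if "Q l" for l using that by (simp add: Q_def)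
  have "Q 0" using less.prems(2) by (simp add: Q_def)
  then have "Q i" unfolding i_def using Q_less by (rule GreatestI_nat)
  then have i: "i < k" "i = 0 \<or> \<omega> \<in> C i" by (simp_all add: Q_def)
  have i_max: "l \<le> i" if "l < k" "\<omega> \<in> C l" for l
  proof -
    have "Q l" using that by (simp add: Q_def)
    then show ?thesis unfolding i_def using Q_less by (rule Greatest_le_nat)
  qed
  obtain j where j: "adapt_time C j \<omega> = enat i"
  proof (cases "i = 0")
    case True
    then show ?thesis using that[of 0] by (simp add: zero_enat_def)
  next
    case False
    then show ?thesis using less.IH[OF i(1)] i(2) that by (auto simp del: adapt_time.simps)
  qed
  have "Inf {enat l |l. enat i < enat l \<and> \<omega> \<in> C l} = enat k"
  proof (rule antisym)
    show "Inf {enat l |l. enat i < enat l \<and> \<omega> \<in> C l} \<le> enat k"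
      using less.prems(1) i by (intro Inf_lower CollectI exI[of _ k]) simp
    show "enat k \<le> Inf {enat l |l. enat i < enat l \<and> \<omega> \<in> C l}"
    proof (rule Inf_greatest)
      fix v assume "v \<in> {enat l |l. enat i < enat l \<and> \<omega> \<in> C l}"
      then obtain l where l: "v = enat l" "i < l" "\<omega> \<in> C l" by auto
      with i_max[of l] have "\<not> l < k" by auto
      then show "enat k \<le> v" using l by simp
    qed
  qed
  then show ?case using j by (intro exI[of _ j]) simp
qed

text \<open>Each adaptation at \<open>Suc k\<close> is the adaptation time of some index
  \<open>Suc (J k)\<close>. As \<open>J\<close> is injective, the left side is a finite part of the
  nonnegative series on the right.\<close>

lemma sum_indicator_le_suminf_inverse_adapt_time:
  "(\<Sum>k<n. ennreal (indicator (C (Suc k)) \<omega> / real (Suc k)))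
    \<le> (\<Sum>j. inverse (ennreal_of_enat (adapt_time C (Suc j) \<omega>)))"
proof -
  define K where "K = {k. k < n \<and> \<omega> \<in> C (Suc k)}"
  have fin: "finite K" by (simp add: K_def)
  have "\<forall>k\<in>K. \<exists>j. adapt_time C (Suc j) \<omega> = enat (Suc k)"
    unfolding K_def using adapt_time_hits[of \<omega> C] by auto
  then obtain J where J: "\<And>k. k \<in> K \<Longrightarrow> adapt_time C (Suc (J k)) \<omega> = enat (Suc k)"
    by (metis (no_types))
  have inj: "inj_on J K" by (rule inj_onI) (metis J enat.inject nat.inject)
  have "(\<Sum>k<n. ennreal (indicator (C (Suc k)) \<omega> / real (Suc k)))
      = (\<Sum>k\<in>K. ennreal (indicator (C (Suc k)) \<omega> / real (Suc k)))"
    by (rule sum.mono_neutral_right) (auto simp: K_def indicator_def)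
  also have "\<dots> = (\<Sum>k\<in>K. inverse (ennreal_of_enat (adapt_time C (Suc (J k)) \<omega>)))"
  proof (rule sum.cong[OF refl])
    fix k assume k: "k \<in> K"
    then have "ennreal (indicator (C (Suc k)) \<omega> / real (Suc k)) = ennreal (inverse (real (Suc k)))"
      by (simp add: K_def inverse_eq_divide)
    also have "\<dots> = inverse (of_nat (Suc k))"
      by (subst inverse_ennreal[symmetric]) (auto simp: ennreal_of_nat_eq_real_of_nat)
    finally show "ennreal (indicator (C (Suc k)) \<omega> / real (Suc k))
        = inverse (ennreal_of_enat (adapt_time C (Suc (J k)) \<omega>))"
      unfolding J[OF k] by (simp only: ennreal_of_enat_enat)
  qed
  also have "\<dots> = (\<Sum>j\<in>J ` K. inverse (ennreal_of_enat (adapt_time C (Suc j) \<omega>)))"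
    by (simp add: sum.reindex[OF inj])
  also have "\<dots> \<le> (\<Sum>j. inverse (ennreal_of_enat (adapt_time C (Suc j) \<omega>)))"
    using fin by (intro sum_le_suminf) auto
  finally show ?thesis .
qed

lemma borel_measurable_adapt_time:
  assumes C: "\<And>k. 1 \<le> k \<Longrightarrow> C k \<in> sets M"
  shows "adapt_time C j \<in> borel_measurable M"
proof (induction j)
  case 0
  have "adapt_time C 0 = (\<lambda>\<omega>. 0)" by (rule ext) simp
  then show ?case by simp
next
  case (Suc j)
  \<comment> \<open>Giving the value infinity to indices that fail the condition turns the infimum
    over a set depending on \<open>\<omega>\<close> into a countable infimum of measurable
    functions.\<close>
  define hit where "hit k \<omega> = (if adapt_time C j \<omega> < enat k \<and> \<omega> \<in> C k then enat k else \<infinity>)" for k \<omega>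
  have "hit k \<in> borel_measurable M" for k
  proof (cases "1 \<le> k")
    case True
    note [measurable] = Suc C[OF True]
    show ?thesis unfolding hit_def by measurable
  next
    \<comment> \<open>Nothing is known about the measurability of \<open>C 0\<close>, but no time
      lies strictly below 0, so \<open>hit 0\<close> is constant.\<close>
    case False
    then have "k = 0" by simp
    then have "hit k = (\<lambda>\<omega>. \<infinity>)" by (simp add: fun_eq_iff hit_def enat_0)
    then show ?thesis by simp
  qed
  then have "(\<lambda>\<omega>. INF k. hit k \<omega>) \<in> borel_measurable M"
    by (intro borel_measurable_INF) auto
  moreover have "adapt_time C (Suc j) = (\<lambda>\<omega>. INF k. hit k \<omega>)"
  proof
    fix \<omega>
    have "Inf {enat k |k. adapt_time C j \<omega> < enat k \<and> \<omega> \<in> C k} = (INF k. hit k \<omega>)"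
    proof (rule antisym)
      show "Inf {enat k |k. adapt_time C j \<omega> < enat k \<and> \<omega> \<in> C k} \<le> (INF k. hit k \<omega>)"
        by (intro INF_greatest) (auto simp: hit_def intro!: Inf_lower)
      show "(INF k. hit k \<omega>) \<le> Inf {enat k |k. adapt_time C j \<omega> < enat k \<and> \<omega> \<in> C k}"
      proof (rule Inf_greatest)
        fix v assume "v \<in> {enat k |k. adapt_time C j \<omega> < enat k \<and> \<omega> \<in> C k}"
        then obtain k where k: "v = enat k" "adapt_time C j \<omega> < enat k" "\<omega> \<in> C k" by auto
        then have "hit k \<omega> = v" by (simp add: hit_def)
        then show "(INF k. hit k \<omega>) \<le> v" by (metis INF_lower UNIV_I)
      qed
    qed
    then show "adapt_time C (Suc j) \<omega> = (INF k. hit k \<omega>)" by simp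
  qed
  ultimately show ?case by simp
qed

lemma borel_measurable_ennreal_of_enat: "ennreal_of_enat \<in> borel_measurable borel"
  by (intro borel_measurable_continuous_onI continuous_at_imp_continuous_on ballI isCont_ennreal_of_enat)

text \<open>Both alternatives yield almost sure finiteness of the series of
  \<open>indicator (C (Suc k)) / Suc k\<close>: the first by exchanging sum and integral, the second
  by pathwise domination through the inverse adaptation times. Kronecker's lemma then applies path
  by path.\<close>

lemma (in prob_space) AE_adaptation_rate_tendsto_0:
  assumes C: "\<And>k. 1 \<le> k \<Longrightarrow> C k \<in> sets M"
    and rate: "summable (\<lambda>k. measure M (C (Suc k)) / real (Suc k)) \<or>
      (\<Sum>j. \<integral>\<^sup>+ \<omega>. inverse (ennreal_of_enat (adapt_time C (Suc j) \<omega>)) \<partial>M) < \<infinity>"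
  shows "AE \<omega> in M. (\<lambda>n. (\<Sum>k<n. indicator (C (Suc k)) \<omega>) / real n) \<longlonglongrightarrow> (0 :: real)"
proof -
  have [measurable]: "C (Suc k) \<in> sets M" for k using C by simp
  define a :: "nat \<Rightarrow> 'a \<Rightarrow> real" where "a k \<omega> = indicator (C (Suc k)) \<omega> / real (Suc k)" for k \<omega>
  have a_meas [measurable]: "a k \<in> borel_measurable M" for k unfolding a_def by measurable
  have "AE \<omega> in M. (\<Sum>k. ennreal (a k \<omega>)) \<noteq> \<infinity>"
    using rate
  proof
    assume s: "summable (\<lambda>k. measure M (C (Suc k)) / real (Suc k))"
    have "(\<integral>\<^sup>+\<omega>. ennreal (a k \<omega>) \<partial>M) = ennreal (measure M (C (Suc k)) / real (Suc k))" for k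
      unfolding a_def
      by (subst nn_integral_eq_integral) (simp_all add: integrable_divide_zero integrable_real_indicator emeasure_eq_measure)
    then have "(\<integral>\<^sup>+\<omega>. (\<Sum>k. ennreal (a k \<omega>)) \<partial>M)
        = (\<Sum>k. ennreal (measure M (C (Suc k)) / real (Suc k)))"
      by (subst nn_integral_suminf) auto
    also have "\<dots> < \<infinity>" using s by (subst suminf_ennreal2) auto
    finally show ?thesis by (intro nn_integral_PInf_AE) auto
  next
    assume s: "(\<Sum>j. \<integral>\<^sup>+ \<omega>. inverse (ennreal_of_enat (adapt_time C (Suc j) \<omega>)) \<partial>M) < \<infinity>"
    note [measurable] = measurable_compose[OF borel_measurable_adapt_time borel_measurable_ennreal_of_enat, OF C]
    have "(\<integral>\<^sup>+\<omega>. (\<Sum>j. inverse (ennreal_of_enat (adapt_time C (Suc j) \<omega>))) \<partial>M) < \<infinity>"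
      using s by (subst nn_integral_suminf) (simp_all del: adapt_time.simps)
    then have "AE \<omega> in M. (\<Sum>j. inverse (ennreal_of_enat (adapt_time C (Suc j) \<omega>))) \<noteq> \<infinity>"
      by (intro nn_integral_PInf_AE) (simp_all del: adapt_time.simps)
    then show ?thesis
    proof eventually_elim
      case (elim \<omega>)
      have "(\<Sum>k. ennreal (a k \<omega>)) \<le> (\<Sum>j. inverse (ennreal_of_enat (adapt_time C (Suc j) \<omega>)))"
        unfolding a_def by (rule suminf_le_const[OF _ sum_indicator_le_suminf_inverse_adapt_time]) simp
      then show ?case using elim by (auto simp: top_unique)
    qed
  qed
  then show ?thesis
  proof eventually_elim
    case (elim \<omega>)
    have "summable (\<lambda>k. a k \<omega>)"
      using elim by (intro summable_suminf_not_top) (auto simp: a_def)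
    then show ?case unfolding a_def by (rule kronecker_div_of_nat)
  qed
qed

section \<open>Total variation distance and integrals\<close>

text \<open>A supremum in the reals bounds its members only if the family is bounded; differences of
  probabilities lie within 1.\<close>

lemma measure_diff_le_tv_dist:
  assumes "prob_space \<mu>" "prob_space \<nu>" "A \<in> sets \<mu>"
  shows "\<bar>measure \<mu> A - measure \<nu> A\<bar> \<le> tv_dist \<mu> \<nu>"
  unfolding tv_dist_def
proof (rule cSUP_upper[OF assms(3)], rule bdd_aboveI2)
  fix A
  have "measure \<mu> A \<le> 1" "measure \<nu> A \<le> 1"
    using assms(1,2) by (auto intro: prob_space.prob_le_1)
  moreover have "0 \<le> measure \<mu> A" "0 \<le> measure \<nu> A" by auto
  ultimately show "\<bar>measure \<mu> A - measure \<nu> A\<bar> \<le> 1" by linarith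
qed

text \<open>The sum counts the integers from 1 up to \<open>y\<close>, hence equals the floor of
  \<open>y\<close>.\<close>

lemma sum_indicator_of_nat_le_approx:
  fixes y :: real
  assumes "0 \<le> y" "y \<le> real n"
  shows "\<bar>y - (\<Sum>i=1..n. of_bool (real i \<le> y))\<bar> \<le> 1"
proof -
  have "{1..n} \<inter> {i. real i \<le> y} = {1..nat \<lfloor>y\<rfloor>}"
    using assms by (auto simp: le_nat_floor) linarith+
  then have "(\<Sum>i=1..n. of_bool (real i \<le> y)) = (real (nat \<lfloor>y\<rfloor>))"
    by (simp add: of_bool_def sum.If_cases)
  then show ?thesis using assms(1) by linarith
qed

text \<open>Approximating \<open>n f\<close> by the sum of the indicators of its superlevel sets at
  \<open>1, \<dots>, n\<close> costs at most 1, hence \<open>1/n\<close> after division by \<open>n\<close>.\<close>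
lemma integral_diff_le_tv_dist_unit:
  fixes f :: "'x \<Rightarrow> real"
  assumes \<mu>: "prob_space \<mu>" and \<nu>: "prob_space \<nu>" and sets: "sets \<nu> = sets \<mu>"
    and f [measurable]: "f \<in> borel_measurable \<mu>"
    and f01: "\<And>x. x \<in> space \<mu> \<Longrightarrow> 0 \<le> f x \<and> f x \<le> 1"
  shows "\<bar>(\<integral>x. f x \<partial>\<mu>) - (\<integral>x. f x \<partial>\<nu>)\<bar> \<le> tv_dist \<mu> \<nu>"
proof -
  interpret \<mu>: prob_space \<mu> by fact
  interpret \<nu>: prob_space \<nu> by fact
  note [measurable_cong] = sets
  have space: "space \<nu> = space \<mu>" using sets by (rule sets_eq_imp_space_eq)
  let ?D = "(\<integral>x. f x \<partial>\<mu>) - (\<integral>x. f x \<partial>\<nu>)"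
  have approx: "\<bar>?D\<bar> \<le> tv_dist \<mu> \<nu> + 2 / real n" if n: "0 < n" for n
  proof -
    define L where "L i = {x \<in> space \<mu>. real i \<le> real n * f x}" for i
    have L [measurable]: "L i \<in> sets \<mu>" for i unfolding L_def by measurable
    define h where "h x = (\<Sum>i=1..n. indicator (L i) x :: real)" for x
    have h_near: "\<bar>real n * f x - h x\<bar> \<le> 1" if "x \<in> space \<mu>" for x
    proof -
      have "h x = (\<Sum>i=1..n. of_bool (real i \<le> real n * f x))"
        unfolding h_def L_def using that by (simp add: indicator_def)
      then show ?thesis
        using sum_indicator_of_nat_le_approx[of "real n * f x" n] f01[OF that]
        by (simp add: mult_left_le)
    qed
    \<comment> \<open>Stated for an arbitrary probability measure on the same sigma-algebra, so that
      it serves for both \<open>\<mu>\<close> and \<open>\<nu>\<close>: the uniform error 1 survives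
      integration.\<close>
    have near: "\<bar>real n * (\<integral>x. f x \<partial>\<kappa>) - (\<Sum>i=1..n. measure \<kappa> (L i))\<bar> \<le> 1"
      if \<kappa>: "prob_space \<kappa>" and s [measurable_cong]: "sets \<kappa> = sets \<mu>" for \<kappa>
    proof -
      interpret \<kappa>: prob_space \<kappa> by fact
      have sp: "space \<kappa> = space \<mu>" using s by (rule sets_eq_imp_space_eq)
      have f_int: "integrable \<kappa> f"
        using f01 sp by (intro \<kappa>.integrable_const_bound[of _ 1]) auto
      have L_int: "integrable \<kappa> (indicator (L i) :: _ \<Rightarrow> real)" for i
        by (intro integrable_real_indicator) (auto simp: \<kappa>.emeasure_eq_measure)
      have h_int: "integrable \<kappa> h"
        unfolding h_def by (intro Bochner_Integration.integrable_sum L_int)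
      have "(\<integral>x. h x \<partial>\<kappa>) = (\<Sum>i=1..n. measure \<kappa> (L i))"
        unfolding h_def by (subst Bochner_Integration.integral_sum) (auto intro: L_int)
      then have "real n * (\<integral>x. f x \<partial>\<kappa>) - (\<Sum>i=1..n. measure \<kappa> (L i)) = (\<integral>x. real n * f x - h x \<partial>\<kappa>)"
        using f_int h_int by simp
      also have "\<bar>\<dots>\<bar> \<le> (\<integral>x. \<bar>real n * f x - h x\<bar> \<partial>\<kappa>)" by (rule integral_abs_bound)
      also have "\<dots> \<le> (\<integral>x. 1 \<partial>\<kappa>)"
        using f_int h_int h_near sp by (intro integral_mono) auto
      also have "\<dots> = 1" by (simp add: \<kappa>.prob_space)
      finally show ?thesis .
    qed
    have "\<bar>(\<Sum>i=1..n. measure \<mu> (L i)) - (\<Sum>i=1..n. measure \<nu> (L i))\<bar>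
        \<le> (\<Sum>i=1..n. \<bar>measure \<mu> (L i) - measure \<nu> (L i)\<bar>)"
      unfolding sum_subtractf[symmetric] by (rule sum_abs)
    also have "\<dots> \<le> (\<Sum>i=1..n. tv_dist \<mu> \<nu>)"
      by (intro sum_mono measure_diff_le_tv_dist \<mu> \<nu> L)
    finally have "\<bar>real n * (\<integral>x. f x \<partial>\<mu>) - real n * (\<integral>x. f x \<partial>\<nu>)\<bar> \<le> real n * tv_dist \<mu> \<nu> + 2"
      using near[OF \<mu> refl] near[OF \<nu> sets] by simp
    then have "real n * \<bar>?D\<bar> \<le> real n * tv_dist \<mu> \<nu> + 2"
      by (simp add: right_diff_distrib[symmetric] abs_mult)
    then show ?thesis using n by (simp add: field_simps)
  qed
  \<comment> \<open>The left side of \<open>approx\<close> does not depend on \<open>n\<close>, so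
    letting \<open>n\<close> tend to infinity removes the discretisation error.\<close>
  have "(\<lambda>n. tv_dist \<mu> \<nu> + 2 / real n) \<longlonglongrightarrow> tv_dist \<mu> \<nu> + 0"
    by (intro tendsto_add tendsto_const lim_const_over_n)
  then have "(\<lambda>n. tv_dist \<mu> \<nu> + 2 / real n) \<longlonglongrightarrow> tv_dist \<mu> \<nu>" by simp
  then show ?thesis
    by (rule LIMSEQ_le_const) (auto intro!: exI[of _ 1] approx)
qed

text \<open>The affine map from \<open>[-b, b]\<close> onto \<open>[0, 1]\<close> reduces this to
  the unit case; its scale is the factor \<open>2 * b\<close>.\<close>

lemma integral_diff_le_tv_dist:
  fixes f :: "'x \<Rightarrow> real"
  assumes \<mu>: "prob_space \<mu>" and \<nu>: "prob_space \<nu>" and sets: "sets \<nu> = sets \<mu>"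
    and f [measurable]: "f \<in> borel_measurable \<mu>"
    and b: "0 < b" "\<And>x. x \<in> space \<mu> \<Longrightarrow> \<bar>f x\<bar> \<le> b"
  shows "\<bar>(\<integral>x. f x \<partial>\<mu>) - (\<integral>x. f x \<partial>\<nu>)\<bar> \<le> 2 * b * tv_dist \<mu> \<nu>"
proof -
  interpret \<mu>: prob_space \<mu> by fact
  interpret \<nu>: prob_space \<nu> by fact
  note [measurable_cong] = sets
  have space: "space \<nu> = space \<mu>" using sets by (rule sets_eq_imp_space_eq)
  have f_int: "integrable \<mu> f" "integrable \<nu> f"
    using b(2) space
    by (auto intro!: \<mu>.integrable_const_bound[of _ b] \<nu>.integrable_const_bound[of _ b])
  define g where "g x = (f x + b) / (2 * b)" for x
  have [measurable]: "g \<in> borel_measurable \<mu>" unfolding g_def by measurable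
  have "\<bar>(\<integral>x. g x \<partial>\<mu>) - (\<integral>x. g x \<partial>\<nu>)\<bar> \<le> tv_dist \<mu> \<nu>"
  proof (rule integral_diff_le_tv_dist_unit[OF \<mu> \<nu> sets])
    fix x assume "x \<in> space \<mu>"
    then show "0 \<le> g x \<and> g x \<le> 1"
      using b(1) b(2)[of x] by (auto simp: g_def abs_le_iff divide_le_eq)
  qed measurable
  moreover have "(\<integral>x. g x \<partial>\<mu>) = ((\<integral>x. f x \<partial>\<mu>) + b) / (2 * b)"
    unfolding g_def using f_int by (simp add: \<mu>.prob_space)
  moreover have "(\<integral>x. g x \<partial>\<nu>) = ((\<integral>x. f x \<partial>\<nu>) + b) / (2 * b)"
    unfolding g_def using f_int by (simp add: \<nu>.prob_space)
  ultimately have "\<bar>((\<integral>x. f x \<partial>\<mu>) - (\<integral>x. f x \<partial>\<nu>)) / (2 * b)\<bar> \<le> tv_dist \<mu> \<nu>"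
    by (simp add: diff_divide_distrib[symmetric])
  then show ?thesis using b(1) by (simp add: abs_divide field_simps)
qed

section \<open>Families of Markov kernels\<close>

text \<open>The definition appends a step at the end, whereas the Poisson equation needs the first
  step split off. Associativity of bind moves between the two.\<close>

lemma kernel_power_Suc_left:
  assumes K: "markov_kernel X K" and x: "x \<in> space X"
  shows "kernel_power X K (Suc n) x = K x \<bind> kernel_power X K n"
proof (induction n)
  case 0
  have K_sub: "K \<in> X \<rightarrow>\<^sub>M subprob_algebra X"
    using K by (simp add: markov_kernel_def measurable_prob_algebraD)
  have "kernel_power X K 0 = return X" by (rule ext) simp
  moreover have "return X x \<bind> K = K x" by (rule bind_return[OF K_sub x])
  moreover have "K x \<bind> return X = K x"
    by (rule bind_return'') (rule sets_kernel[OF K_sub x])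
  ultimately show ?case by simp
next
  case (Suc n)
  have K_sub: "K \<in> X \<rightarrow>\<^sub>M subprob_algebra X"
    using K by (simp add: markov_kernel_def measurable_prob_algebraD)
  have "kernel_power X K n \<in> K x \<rightarrow>\<^sub>M subprob_algebra X"
    using measurable_prob_algebraD[OF kernel_power_measurable[OF K, of n]]
    by (simp cong: measurable_cong_sets add: sets_kernel[OF K_sub x])
  then have "(K x \<bind> kernel_power X K n) \<bind> K = K x \<bind> (\<lambda>y. kernel_power X K n y \<bind> K)"
    using K_sub by (rule bind_assoc)
  moreover have "kernel_power X K (Suc n) = (\<lambda>y. kernel_power X K n y \<bind> K)"
    by (rule ext) simp
  ultimately show ?case
    using Suc by (simp only: kernel_power.simps(2)[of X K "Suc n" x])
qed

text \<open>The sigma-algebra on measures is generated by the evaluations at measurable sets, so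
  measurability of each \<open>P s x A\<close> in \<open>(s, x)\<close> lifts to the measure-valued
  map.\<close>

lemma measurable_kernel_family:
  assumes kernel: "\<And>s. s \<in> space S \<Longrightarrow> markov_kernel X (P s)"
    and meas: "\<And>A. A \<in> sets X \<Longrightarrow> (\<lambda>(s, x). measure (P s x) A) \<in> borel_measurable (S \<Otimes>\<^sub>M X)"
  shows "(\<lambda>(s, x). P s x) \<in> S \<Otimes>\<^sub>M X \<rightarrow>\<^sub>M prob_algebra X"
proof -
  have P: "prob_space (P s x)" "sets (P s x) = sets X" if "s \<in> space S" "x \<in> space X" for s x
    using measurable_space[OF kernel[OF that(1), unfolded markov_kernel_def] that(2)]
    by (auto simp: space_prob_algebra)
  show ?thesis
  proof (rule measurable_prob_algebraI[OF _ measurable_subprob_algebra])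
    fix A assume A: "A \<in> sets X"
    have "(\<lambda>a. ennreal (case a of (s, x) \<Rightarrow> measure (P s x) A)) \<in> borel_measurable (S \<Otimes>\<^sub>M X)"
      using meas[OF A] by measurable
    then show "(\<lambda>a. emeasure (case a of (s, x) \<Rightarrow> P s x) A) \<in> borel_measurable (S \<Otimes>\<^sub>M X)"
    proof (rule measurable_cong[THEN iffD1, rotated])
      fix a assume "a \<in> space (S \<Otimes>\<^sub>M X)"
      then show "ennreal (case a of (s, x) \<Rightarrow> measure (P s x) A) = emeasure (case a of (s, x) \<Rightarrow> P s x) A"
        using P by (auto simp: space_pair_measure finite_measure.emeasure_eq_measure prob_space.finite_measure)
    qed
  qed (use P in \<open>auto simp: space_pair_measure intro: prob_space_imp_subprob_space\<close>)
qed

lemma measurable_kernel_power_family: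
  assumes P: "(\<lambda>(s, x). P s x) \<in> S \<Otimes>\<^sub>M X \<rightarrow>\<^sub>M prob_algebra X"
  shows "(\<lambda>(s, x). kernel_power X (P s) n x) \<in> S \<Otimes>\<^sub>M X \<rightarrow>\<^sub>M prob_algebra X"
proof (induction n)
  case 0
  show ?case by (simp add: measurable_compose[OF measurable_snd measurable_return_prob_space] split_beta')
next
  case (Suc n)
  \<comment> \<open>The pair \<open>p\<close> of parameter and starting point is the source; the
    last step takes its parameter from \<open>fst p\<close>.\<close>
  have "(\<lambda>(p, y). P (fst p) y) = (\<lambda>(s, x). P s x) \<circ> (\<lambda>(p, y). (fst p, y))"
    by (simp add: fun_eq_iff split_beta')
  also have "\<dots> \<in> (S \<Otimes>\<^sub>M X) \<Otimes>\<^sub>M X \<rightarrow>\<^sub>M prob_algebra X"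
    by (rule measurable_comp[OF _ P]) measurable
  finally have "(\<lambda>p. (case p of (s, x) \<Rightarrow> kernel_power X (P s) n x) \<bind> P (fst p)) \<in> S \<Otimes>\<^sub>M X \<rightarrow>\<^sub>M prob_algebra X"
    by (rule measurable_bind_prob_space2[OF Suc])
  then show ?case by (simp add: split_beta')
qed

text \<open>The hypothesis on rectangles determines, by a \<open>\<pi>\<close>-\<open>\<lambda>\<close> argument, the joint law of
  \<open>(U, Y)\<close> on every event of \<open>F\<close>.\<close>
lemma real_cond_exp_kernel:
  fixes f :: "'s \<Rightarrow> 'x \<Rightarrow> real"
  assumes M: "prob_space M" and F: "subalgebra M F"
    and P: "(\<lambda>(s, x). P s x) \<in> S \<Otimes>\<^sub>M X \<rightarrow>\<^sub>M prob_algebra X"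
    and U: "U \<in> F \<rightarrow>\<^sub>M S" and V: "V \<in> F \<rightarrow>\<^sub>M X" and Y: "Y \<in> M \<rightarrow>\<^sub>M X"
    and trans: "\<And>A. A \<in> sets X \<Longrightarrow>
      AE \<omega> in M. real_cond_exp M F (indicator {\<omega> \<in> space M. Y \<omega> \<in> A}) \<omega> = measure (P (U \<omega>) (V \<omega>)) A"
    and f: "(\<lambda>(s, x). f s x) \<in> borel_measurable (S \<Otimes>\<^sub>M X)"
    and bound: "\<And>s x. s \<in> space S \<Longrightarrow> x \<in> space X \<Longrightarrow> \<bar>f s x\<bar> \<le> c"
  shows "AE \<omega> in M. real_cond_exp M F (\<lambda>\<omega>. f (U \<omega>) (Y \<omega>)) \<omega> = (\<integral>y. f (U \<omega>) y \<partial>P (U \<omega>) (V \<omega>))"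
proof -
  interpret prob_space M by fact
  interpret finite_measure_subalgebra M F by unfold_locales fact
  note [measurable] = P f Y
  note U_M [measurable] = measurable_from_subalg[OF F U]
  note V_M [measurable] = measurable_from_subalg[OF F V]
  define K where "K \<omega> = P (U \<omega>) (V \<omega>)" for \<omega>
  have K_F: "K \<in> F \<rightarrow>\<^sub>M prob_algebra X"
    unfolding K_def using measurable_compose[OF measurable_Pair[OF U V] P] by simp
  have K_M [measurable]: "K \<in> M \<rightarrow>\<^sub>M prob_algebra X"
    using measurable_from_subalg[OF F K_F] .
  have K_prob: "prob_space (K \<omega>)" and K_sets: "sets (K \<omega>) = sets X" if "\<omega> \<in> space M" for \<omega>
    using measurable_space[OF K_M that] by (auto simp: space_prob_algebra)
  have U_space: "U \<omega> \<in> space S" and Y_space: "Y \<omega> \<in> space X" if "\<omega> \<in> space M" for \<omega>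
    using that by (auto intro: measurable_space[OF U_M] measurable_space[OF Y])
  \<comment> \<open>\<open>L \<omega>\<close> is the candidate for the conditional law of
    \<open>(U, Y)\<close> given \<open>F\<close>: the first coordinate is frozen at
    \<open>U \<omega>\<close> and the second is drawn from \<open>K \<omega>\<close>.\<close>
  define L where "L \<omega> = distr (K \<omega>) (S \<Otimes>\<^sub>M X) (Pair (U \<omega>))" for \<omega>
  have L_F: "L \<in> F \<rightarrow>\<^sub>M prob_algebra (S \<Otimes>\<^sub>M X)"
    unfolding L_def
  proof (rule measurable_distr_prob_space2[OF K_F])
    show "(\<lambda>(\<omega>, y). (U \<omega>, y)) \<in> F \<Otimes>\<^sub>M X \<rightarrow>\<^sub>M S \<Otimes>\<^sub>M X" using U by measurable
  qed
  have L_M: "L \<in> M \<rightarrow>\<^sub>M prob_algebra (S \<Otimes>\<^sub>M X)"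
    using measurable_from_subalg[OF F L_F] .
  have Pair_meas: "Pair (U \<omega>) \<in> K \<omega> \<rightarrow>\<^sub>M S \<Otimes>\<^sub>M X" if "\<omega> \<in> space M" for \<omega>
    using U_space[OF that] by (simp cong: measurable_cong_sets add: K_sets[OF that])
  have L_int: "(\<integral>z. case_prod f z \<partial>L \<omega>) = (\<integral>y. f (U \<omega>) y \<partial>K \<omega>)" if "\<omega> \<in> space M" for \<omega>
    unfolding L_def by (subst integral_distr[OF Pair_meas[OF that] f]) simp
  have f_bound: "\<bar>case_prod f z\<bar> \<le> c" if "z \<in> space (S \<Otimes>\<^sub>M X)" for z
    using that bound by (auto simp: space_pair_measure)
  let ?h = "\<lambda>\<omega>. \<integral>y. f (U \<omega>) y \<partial>K \<omega>"
  have h_meas: "?h \<in> borel_measurable F"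
  proof (rule measurable_cong[THEN iffD1])
    show "(\<integral>z. case_prod f z \<partial>L \<omega>) = ?h \<omega>" if "\<omega> \<in> space F" for \<omega>
      using that F by (intro L_int) (auto simp: subalgebra_def)
    show "(\<lambda>\<omega>. \<integral>z. case_prod f z \<partial>L \<omega>) \<in> borel_measurable F"
      by (rule measurable_compose[OF measurable_prob_algebraD[OF L_F] integral_measurable_subprob_algebra[OF f]])
  qed
  have h_bound: "\<bar>?h \<omega>\<bar> \<le> c" if "\<omega> \<in> space M" for \<omega>
  proof -
    interpret K\<omega>: prob_space "K \<omega>" by (rule K_prob[OF that])
    have sp: "space (K \<omega>) = space X" using K_sets[OF that] by (rule sets_eq_imp_space_eq)
    have fU: "f (U \<omega>) \<in> borel_measurable (K \<omega>)"
      using measurable_compose[OF Pair_meas[OF that] f] by simp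
    have f_int: "integrable (K \<omega>) (f (U \<omega>))"
      using bound U_space[OF that] sp fU by (intro K\<omega>.integrable_const_bound[of _ c]) auto
    have "\<bar>?h \<omega>\<bar> \<le> (\<integral>y. \<bar>f (U \<omega>) y\<bar> \<partial>K \<omega>)" by (rule integral_abs_bound)
    also have "\<dots> \<le> (\<integral>y. c \<partial>K \<omega>)"
      using bound U_space[OF that] sp f_int by (intro integral_mono) auto
    finally show ?thesis by (simp add: K\<omega>.prob_space)
  qed
  have "AE \<omega> in M. real_cond_exp M F (\<lambda>\<omega>. f (U \<omega>) (Y \<omega>)) \<omega> = ?h \<omega>"
  proof (rule real_cond_exp_charact)
    show "integrable M (\<lambda>\<omega>. f (U \<omega>) (Y \<omega>))"
      using bound U_space Y_space by (intro integrable_const_bound[of _ c]) auto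
    show "integrable M ?h"
      using h_bound measurable_from_subalg[OF F h_meas] by (intro integrable_const_bound[of _ c]) auto
    show "?h \<in> borel_measurable F" by (rule h_meas)
  next
    fix E assume E_F: "E \<in> sets F"
    then have E [measurable]: "E \<in> sets M" using F by (auto simp: subalgebra_def)
    \<comment> \<open>Restricting \<open>M\<close> to \<open>E\<close> turns integrals over
      \<open>E\<close> into plain integrals. The total mass may be below 1, so \<open>N\<close> is
      only a finite measure.\<close>
    define N where "N = density M (\<lambda>\<omega>. ennreal (indicator E \<omega>))"
    have N_sets [measurable_cong]: "sets N = sets M" and N_space: "space N = space M"
      by (simp_all add: N_def)
    have N_finite: "finite_measure N"
      by (rule finite_measureI) (simp add: N_def emeasure_density nn_integral_indicator ennreal_indicator)
    have L_N: "L \<in> N \<rightarrow>\<^sub>M subprob_algebra (S \<Otimes>\<^sub>M X)"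
      using measurable_prob_algebraD[OF L_M] by measurable
    have UY: "(\<lambda>\<omega>. (U \<omega>, Y \<omega>)) \<in> N \<rightarrow>\<^sub>M S \<Otimes>\<^sub>M X" by measurable
    have rect: "emeasure (distr N (S \<Otimes>\<^sub>M X) (\<lambda>\<omega>. (U \<omega>, Y \<omega>))) (A \<times> A') = emeasure (N \<bind> L) (A \<times> A')"
      if A: "A \<in> sets S" and A' [measurable]: "A' \<in> sets X" for A A'
    proof -
      \<comment> \<open>Since \<open>U\<close> is \<open>F\<close>-measurable, the condition that
        \<open>U\<close> lies in \<open>A\<close> can be absorbed into the conditioning event. What
        remains is the hypothesis \<open>trans\<close> on \<open>A'\<close>, integrated over
        \<open>E'\<close>.\<close>
      define E' where "E' = E \<inter> (U -` A \<inter> space F)"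
      have E'_F: "E' \<in> sets F" unfolding E'_def using E_F U A by measurable
      have E'_M [measurable]: "E' \<in> sets M" using E'_F F by (auto simp: subalgebra_def)
      define W where "W = {\<omega> \<in> space M. Y \<omega> \<in> A'}"
      have W [measurable]: "W \<in> sets M" unfolding W_def by measurable
      have W_int: "integrable M (indicator W :: _ \<Rightarrow> real)"
        by (intro integrable_real_indicator) (auto simp: emeasure_eq_measure)
      have q_meas [measurable]: "(\<lambda>\<omega>. measure (K \<omega>) A') \<in> borel_measurable M"
        by (rule measurable_compose[OF K_M measurable_measure_prob_algebra[OF A']])
      have "emeasure (distr N (S \<Otimes>\<^sub>M X) (\<lambda>\<omega>. (U \<omega>, Y \<omega>))) (A \<times> A')
          = emeasure N ((\<lambda>\<omega>. (U \<omega>, Y \<omega>)) -` (A \<times> A') \<inter> space N)"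
        using UY A by (intro emeasure_distr) auto
      also have "\<dots> = (\<integral>\<^sup>+\<omega>. indicator E \<omega> * indicator ((\<lambda>\<omega>. (U \<omega>, Y \<omega>)) -` (A \<times> A') \<inter> space M) \<omega> \<partial>M)"
      proof -
        have "(\<lambda>\<omega>. (U \<omega>, Y \<omega>)) -` (A \<times> A') \<inter> space M \<in> sets M"
          using measurable_sets[OF UY, of "A \<times> A'"] A by (simp add: N_sets N_space)
        then show ?thesis unfolding N_space
          unfolding N_def by (subst emeasure_density) (auto simp: ennreal_indicator)
      qed
      also have "\<dots> = (\<integral>\<^sup>+\<omega>. indicator (E' \<inter> W) \<omega> \<partial>M)"
        using F by (intro nn_integral_cong) (auto simp: E'_def W_def indicator_def subalgebra_def)
      also have "\<dots> = ennreal (\<integral>\<omega>\<in>E'. indicator W \<omega> \<partial>M)"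
        by (simp add: set_lebesgue_integral_def indicator_inter_arith[symmetric] emeasure_eq_measure)
      also have "(\<integral>\<omega>\<in>E'. indicator W \<omega> \<partial>M) = (\<integral>\<omega>\<in>E'. real_cond_exp M F (indicator W) \<omega> \<partial>M)"
        by (rule real_cond_exp_intA[OF W_int E'_F])
      also have "\<dots> = (\<integral>\<omega>\<in>E'. measure (K \<omega>) A' \<partial>M)"
        using trans[OF A'] unfolding set_lebesgue_integral_def W_def K_def[symmetric]
        by (intro integral_cong_AE) (auto elim: AE_mp)
      also have "ennreal \<dots> = (\<integral>\<^sup>+\<omega>. ennreal (indicator E' \<omega> * measure (K \<omega>) A') \<partial>M)"
        unfolding set_lebesgue_integral_def real_scaleR_def
      proof (rule nn_integral_eq_integral[symmetric])
        show "integrable M (\<lambda>\<omega>. indicator E' \<omega> * measure (K \<omega>) A')"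
          by (intro integrable_const_bound[of _ 1] AE_I2)
             (auto simp: indicator_def intro: prob_space.prob_le_1[OF K_prob])
      qed simp
      also have "\<dots> = (\<integral>\<^sup>+\<omega>. ennreal (indicator E \<omega>) * emeasure (L \<omega>) (A \<times> A') \<partial>M)"
      proof (rule nn_integral_cong)
        fix \<omega> assume \<omega>: "\<omega> \<in> space M"
        interpret K\<omega>: prob_space "K \<omega>" by (rule K_prob[OF \<omega>])
        have "emeasure (L \<omega>) (A \<times> A') = emeasure (K \<omega>) (Pair (U \<omega>) -` (A \<times> A') \<inter> space (K \<omega>))"
          unfolding L_def using Pair_meas[OF \<omega>] A by (intro emeasure_distr) auto
        also have "Pair (U \<omega>) -` (A \<times> A') \<inter> space (K \<omega>) = (if U \<omega> \<in> A then A' else {})"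
          using sets.sets_into_space[OF A'] sets_eq_imp_space_eq[OF K_sets[OF \<omega>]] by auto
        finally show "ennreal (indicator E' \<omega> * measure (K \<omega>) A') = ennreal (indicator E \<omega>) * emeasure (L \<omega>) (A \<times> A')"
          using \<omega> F by (auto simp: E'_def indicator_def K\<omega>.emeasure_eq_measure subalgebra_def)
      qed
      also have "\<dots> = (\<integral>\<^sup>+\<omega>. emeasure (L \<omega>) (A \<times> A') \<partial>N)"
        unfolding N_def
        using measurable_emeasure_kernel[OF measurable_prob_algebraD[OF L_M], of "A \<times> A'"] A
        by (subst nn_integral_density) auto
      also have "\<dots> = emeasure (N \<bind> L) (A \<times> A')"
        using L_N A not_empty by (subst emeasure_bind) (auto simp: N_space)
      finally show ?thesis .
    qed
    \<comment> \<open>Measurable rectangles are stable under intersection and generate the product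
      sigma-algebra, so the two finite measures agree.\<close>
    have law: "distr N (S \<Otimes>\<^sub>M X) (\<lambda>\<omega>. (U \<omega>, Y \<omega>)) = N \<bind> L"
    proof (rule measure_eqI_generator_eq[OF Int_stable_pair_measure_generator pair_measure_closed])
      show "sets (distr N (S \<Otimes>\<^sub>M X) (\<lambda>\<omega>. (U \<omega>, Y \<omega>))) = sigma_sets (space S \<times> space X) {a \<times> b |a b. a \<in> sets S \<and> b \<in> sets X}"
        by (simp add: sets_pair_measure)
      show "sets (N \<bind> L) = sigma_sets (space S \<times> space X) {a \<times> b |a b. a \<in> sets S \<and> b \<in> sets X}"
        unfolding sets_pair_measure[symmetric]
        using not_empty by (intro sets_bind sets_kernel[OF L_N]) (auto simp: N_space)
      show "range (\<lambda>_::nat. space S \<times> space X) \<subseteq> {a \<times> b |a b. a \<in> sets S \<and> b \<in> sets X}" by auto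
      show "emeasure (distr N (S \<Otimes>\<^sub>M X) (\<lambda>\<omega>. (U \<omega>, Y \<omega>))) (space S \<times> space X) \<noteq> \<infinity>"
        using finite_measure.emeasure_finite[OF finite_measure.finite_measure_distr[OF N_finite UY]] by simp
    qed (use rect in auto)
    have "(\<integral>\<omega>\<in>E. f (U \<omega>) (Y \<omega>) \<partial>M) = (\<integral>\<omega>. case_prod f (U \<omega>, Y \<omega>) \<partial>N)"
      unfolding N_def set_lebesgue_integral_def by (subst integral_density) auto
    also have "\<dots> = (\<integral>z. case_prod f z \<partial>(N \<bind> L))"
      unfolding law[symmetric] by (rule integral_distr[OF UY f, symmetric])
    also have "\<dots> = (\<integral>\<omega>. \<integral>z. case_prod f z \<partial>L \<omega> \<partial>N)"
    proof (rule integral_bind[OF f f_bound L_N N_finite])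
      show "AE \<omega> in N. emeasure (L \<omega>) (space (L \<omega>)) \<le> ennreal 1"
        using subprob_space_kernel[OF L_N] by (intro AE_I2) (simp add: subprob_space.emeasure_space_le_1)
    qed
    also have "\<dots> = (\<integral>\<omega>. ?h \<omega> \<partial>N)"
      by (intro Bochner_Integration.integral_cong refl L_int) (simp add: N_space)
    also have "\<dots> = (\<integral>\<omega>\<in>E. ?h \<omega> \<partial>M)"
      using measurable_from_subalg[OF F h_meas]
      unfolding N_def set_lebesgue_integral_def by (subst integral_density) auto
    finally show "(\<integral>\<omega>\<in>E. f (U \<omega>) (Y \<omega>) \<partial>M) = (\<integral>\<omega>\<in>E. ?h \<omega> \<partial>M)" .
  qed
  then show ?thesis by (simp add: K_def)
qed

section \<open>The Poisson equation\<close>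

text \<open>Collects the data that do not involve the process. \<open>B\<close> is the constant of
  the mixing rate, and \<open>b\<close> is taken positive because the rescaling of
  \<open>\<phi>\<close> divides by it.\<close>

locale ergodic_kernel_family =
  fixes \<X> :: "'x measure" and \<S> :: "'s measure" and \<pi> :: "'x measure"
    and P :: "'s \<Rightarrow> 'x \<Rightarrow> 'x measure" and B \<rho> b :: real and \<phi> :: "'x \<Rightarrow> real"
  assumes prob_\<pi>: "prob_space \<pi>" and sets_\<pi>: "sets \<pi> = sets \<X>"
    and kernel: "\<And>s. s \<in> space \<S> \<Longrightarrow> markov_kernel \<X> (P s)"
    and joint: "(\<lambda>(s, x). P s x) \<in> \<S> \<Otimes>\<^sub>M \<X> \<rightarrow>\<^sub>M prob_algebra \<X>"
    and \<rho>: "0 \<le> \<rho>" "\<rho> < 1"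
    and mixing: "\<And>s x k. s \<in> space \<S> \<Longrightarrow> x \<in> space \<X> \<Longrightarrow>
      tv_dist (kernel_power \<X> (P s) k x) \<pi> \<le> B * \<rho> ^ k"
    and \<phi> [measurable]: "\<phi> \<in> borel_measurable \<X>"
    and b: "0 < b" "\<And>x. x \<in> space \<X> \<Longrightarrow> \<bar>\<phi> x\<bar> \<le> b"
begin

definition mean :: real where "mean = (\<integral>x. \<phi> x \<partial>\<pi>)"

definition iter :: "nat \<Rightarrow> 's \<Rightarrow> 'x \<Rightarrow> real" where
  "iter i s x = (\<integral>y. \<phi> y \<partial>kernel_power \<X> (P s) i x)"

text \<open>The solution of the Poisson equation \<open>g - P\<^sub>s g = \<phi> - \<pi>(\<phi>)\<close>.\<close>
definition poisson :: "'s \<Rightarrow> 'x \<Rightarrow> real" where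
  "poisson s x = (\<Sum>i. iter i s x - mean)"

lemma kernel_power_prob_sets:
  assumes "s \<in> space \<S>" "x \<in> space \<X>"
  shows "prob_space (kernel_power \<X> (P s) i x)" "sets (kernel_power \<X> (P s) i x) = sets \<X>"
  using measurable_space[OF kernel_power_measurable[OF kernel[OF assms(1)]] assms(2)]
  by (auto simp: space_prob_algebra)

text \<open>Geometric ergodicity tested on \<open>\<phi>\<close>. The bound depends on neither
  \<open>s\<close> nor \<open>x\<close>, which is the source of all uniformity below.\<close>

lemma iter_mean_le:
  assumes "s \<in> space \<S>" "x \<in> space \<X>"
  shows "\<bar>iter i s x - mean\<bar> \<le> 2 * b * B * \<rho> ^ i"
proof -
  note kp = kernel_power_prob_sets[OF assms, of i]
  have "\<bar>iter i s x - mean\<bar> \<le> 2 * b * tv_dist (kernel_power \<X> (P s) i x) \<pi>"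
    unfolding iter_def mean_def
  proof (rule integral_diff_le_tv_dist[OF kp(1) prob_\<pi> _ _ b(1)])
    show "sets \<pi> = sets (kernel_power \<X> (P s) i x)" by (simp add: kp(2) sets_\<pi>)
    show "\<phi> \<in> borel_measurable (kernel_power \<X> (P s) i x)"
      using \<phi> by (simp cong: measurable_cong_sets add: kp(2))
    show "\<bar>\<phi> y\<bar> \<le> b" if "y \<in> space (kernel_power \<X> (P s) i x)" for y
      using that sets_eq_imp_space_eq[OF kp(2)] b(2) by simp
  qed
  also have "\<dots> \<le> 2 * b * (B * \<rho> ^ i)"
    using b(1) mixing[OF assms, of i] by (intro mult_left_mono) auto
  finally show ?thesis by (simp add: mult.assoc)
qed

lemma iter_measurable: "(\<lambda>(s, x). iter i s x) \<in> borel_measurable (\<S> \<Otimes>\<^sub>M \<X>)"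
  using measurable_compose[OF measurable_prob_algebraD[OF measurable_kernel_power_family[OF joint]]
      integral_measurable_subprob_algebra[OF \<phi>], of i]
  by (simp add: iter_def split_beta')

lemma iter_measurable_section:
  assumes "s \<in> space \<S>"
  shows "iter i s \<in> borel_measurable \<X>"
  using measurable_Pair2[OF iter_measurable assms] by simp

lemma geometric_summable: "summable (\<lambda>i. 2 * b * B * \<rho> ^ i)"
  using \<rho> by (intro summable_mult summable_geometric) simp

lemma poisson_abs_summable:
  assumes "s \<in> space \<S>" "x \<in> space \<X>"
  shows "summable (\<lambda>i. \<bar>iter i s x - mean\<bar>)"
  using geometric_summable by (rule summable_comparison_test') (simp add: iter_mean_le[OF assms])

lemma poisson_summable:
  assumes "s \<in> space \<S>" "x \<in> space \<X>"
  shows "summable (\<lambda>i. iter i s x - mean)"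
  using poisson_abs_summable[OF assms] by (rule summable_rabs_cancel)

text \<open>Summing the geometric bounds. Uniformity in \<open>s\<close> is what allows the
  parameter to change along a path at bounded cost.\<close>

lemma poisson_bound:
  assumes "s \<in> space \<S>" "x \<in> space \<X>"
  shows "\<bar>poisson s x\<bar> \<le> 2 * b * B / (1 - \<rho>)"
proof -
  have "\<bar>poisson s x\<bar> \<le> (\<Sum>i. \<bar>iter i s x - mean\<bar>)"
    unfolding poisson_def by (rule summable_rabs[OF poisson_abs_summable[OF assms]])
  also have "\<dots> \<le> (\<Sum>i. 2 * b * B * \<rho> ^ i)"
    by (intro suminf_le iter_mean_le poisson_abs_summable geometric_summable assms)
  also have "\<dots> = 2 * b * B / (1 - \<rho>)"
    using \<rho> by (simp add: suminf_mult suminf_geometric summable_geometric)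
  finally show ?thesis .
qed

lemma poisson_measurable: "(\<lambda>(s, x). poisson s x) \<in> borel_measurable (\<S> \<Otimes>\<^sub>M \<X>)"
proof -
  have "(\<lambda>z. \<Sum>i. iter i (fst z) (snd z) - mean) \<in> borel_measurable (\<S> \<Otimes>\<^sub>M \<X>)"
    using iter_measurable
    by (intro borel_measurable_suminf borel_measurable_diff) (simp_all add: split_beta')
  then show ?thesis by (simp add: poisson_def split_beta')
qed

text \<open>First-step decomposition: averaging over the first move and then running
  \<open>i\<close> steps amounts to running \<open>Suc i\<close> steps.\<close>

lemma integral_iter:
  assumes s: "s \<in> space \<S>" and x: "x \<in> space \<X>"
  shows "(\<integral>y. iter i s y \<partial>P s x) = iter (Suc i) s x"
proof -
  have P: "prob_space (P s x)" "sets (P s x) = sets \<X>"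
    using measurable_space[OF kernel[OF s, unfolded markov_kernel_def] x]
    by (auto simp: space_prob_algebra)
  have kp: "kernel_power \<X> (P s) i \<in> P s x \<rightarrow>\<^sub>M subprob_algebra \<X>"
    using measurable_prob_algebraD[OF kernel_power_measurable[OF kernel[OF s], of i]]
    by (simp cong: measurable_cong_sets add: P(2))
  have "iter (Suc i) s x = (\<integral>y. \<phi> y \<partial>(P s x \<bind> kernel_power \<X> (P s) i))"
    unfolding iter_def kernel_power_Suc_left[OF kernel[OF s] x] ..
  also have "\<dots> = (\<integral>y. iter i s y \<partial>P s x)"
    unfolding iter_def
  proof (rule integral_bind[OF \<phi> b(2) kp prob_space.finite_measure[OF P(1)]])
    show "AE y in P s x. emeasure (kernel_power \<X> (P s) i y) (space (kernel_power \<X> (P s) i y)) \<le> ennreal 1"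
      using subprob_space_kernel[OF kp] by (intro AE_I2) (simp add: subprob_space.emeasure_space_le_1)
  qed
  finally show ?thesis ..
qed

text \<open>Applying \<open>P s\<close> shifts the series by one index, so exactly the term at
  \<open>i = 0\<close>, namely \<open>\<phi> x - mean\<close>, is lost. The geometric bound
  justifies exchanging series and integral.\<close>

lemma poisson_equation:
  assumes s: "s \<in> space \<S>" and x: "x \<in> space \<X>"
  shows "(\<integral>y. poisson s y \<partial>P s x) = poisson s x - \<phi> x + mean"
proof -
  have P: "prob_space (P s x)" "sets (P s x) = sets \<X>"
    using measurable_space[OF kernel[OF s, unfolded markov_kernel_def] x]
    by (auto simp: space_prob_algebra)
  interpret Px: prob_space "P s x" by (rule P(1))
  have sp: "space (P s x) = space \<X>" using P(2) by (rule sets_eq_imp_space_eq)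
  have iter_meas [measurable]: "iter i s \<in> borel_measurable (P s x)" for i
    using iter_measurable_section[OF s, of i] by (simp cong: measurable_cong_sets add: P(2))
  have diff_int: "integrable (P s x) (\<lambda>y. iter i s y - mean)" for i
    using iter_mean_le[OF s, of _ i] sp by (intro Px.integrable_const_bound[of _ "2 * b * B * \<rho> ^ i"]) auto
  have iter_int: "integrable (P s x) (iter i s)" for i
    using Bochner_Integration.integrable_add[OF diff_int[of i] Px.integrable_const[of mean]] by simp
  have norm_le: "(\<integral>y. norm (iter i s y - mean) \<partial>P s x) \<le> 2 * b * B * \<rho> ^ i" for i
  proof -
    have "(\<integral>y. norm (iter i s y - mean) \<partial>P s x) \<le> (\<integral>y. 2 * b * B * \<rho> ^ i \<partial>P s x)"
      using iter_mean_le[OF s, of _ i] sp diff_int by (intro integral_mono) auto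
    then show ?thesis by (simp add: Px.prob_space)
  qed
  have "(\<integral>y. poisson s y \<partial>P s x) = (\<Sum>i. \<integral>y. iter i s y - mean \<partial>P s x)"
    unfolding poisson_def
  proof (rule integral_suminf[OF diff_int])
    show "AE y in P s x. summable (\<lambda>i. norm (iter i s y - mean))"
      using poisson_abs_summable[OF s] sp by auto
    show "summable (\<lambda>i. \<integral>y. norm (iter i s y - mean) \<partial>P s x)"
      using geometric_summable by (rule summable_comparison_test') (use norm_le in simp)
  qed
  also have "\<dots> = (\<Sum>i. iter (Suc i) s x - mean)"
    using iter_int by (simp add: integral_iter[OF s x] Px.prob_space)
  also have "\<dots> = poisson s x - (iter 0 s x - mean)"
    unfolding poisson_def by (rule suminf_split_head[OF poisson_summable[OF s x]])
  also have "iter 0 s x = \<phi> x"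
    using x by (simp add: iter_def integral_return)
  finally show ?thesis by simp
qed

end

section \<open>The law of large numbers for adaptive chains\<close>

text \<open>For a constant parameter the sum telescopes to two boundary terms. A change of parameter
  inserts \<open>g (s (Suc k)) (x (Suc k)) - g (s k) (x (Suc k))\<close>, which costs at most
  \<open>2 * G\<close>.\<close>

lemma abs_sum_poisson_telescope_le:
  fixes g :: "'s \<Rightarrow> 'x \<Rightarrow> real"
  assumes "\<And>j k. \<bar>g (s j) (x k)\<bar> \<le> G"
  shows "\<bar>\<Sum>k<n. g (s (Suc k)) (x (Suc k)) - g (s (Suc k)) (x (Suc (Suc k)))\<bar>
    \<le> 2 * G + 2 * G * (\<Sum>k<n. of_bool (s (Suc k) \<noteq> s k))"
proof -
  let ?R = "\<lambda>n. \<Sum>k<n. g (s (Suc k)) (x (Suc k)) - g (s (Suc k)) (x (Suc (Suc k)))"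
  \<comment> \<open>With the boundary terms removed, the increment from \<open>n\<close> to
    \<open>Suc n\<close> is exactly this parameter change, and induction goes through.\<close>
  have "\<bar>?R n + g (s n) (x (Suc n)) - g (s 0) (x 1)\<bar> \<le> 2 * G * (\<Sum>k<n. of_bool (s (Suc k) \<noteq> s k))"
  proof (induction n)
    case (Suc n)
    have "\<bar>g (s (Suc n)) (x (Suc n)) - g (s n) (x (Suc n))\<bar> \<le> 2 * G * of_bool (s (Suc n) \<noteq> s n)"
      using assms[of "Suc n" "Suc n"] assms[of n "Suc n"] by auto
    then show ?case using Suc by (simp add: distrib_left)
  qed simp
  then show ?thesis using assms[of n "Suc n"] assms[of 0 1] by linarith
qed

theorem theorem20:
  fixes M :: "'a measure" and \<X> :: "'x measure" and \<S> :: "'s measure"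
    and \<pi> :: "'x measure" and P :: "'s \<Rightarrow> 'x \<Rightarrow> 'x measure"
    and F :: "nat \<Rightarrow> 'a measure" and S :: "nat \<Rightarrow> 'a \<Rightarrow> 's" and X :: "nat \<Rightarrow> 'a \<Rightarrow> 'x"
    and B \<rho> :: real and \<phi> :: "'x \<Rightarrow> real"
  assumes "prob_space \<pi>" and "sets \<pi> = sets \<X>"
    and "\<And>s. s \<in> space \<S> \<Longrightarrow> markov_kernel \<X> (P s)"
    and "\<And>s. s \<in> space \<S> \<Longrightarrow> invariant_measure \<pi> (P s)"
    and "\<And>A. A \<in> sets \<X> \<Longrightarrow> (\<lambda>(s, x). measure (P s x) A) \<in> borel_measurable (\<S> \<Otimes>\<^sub>M \<X>)"
    and "prob_space M"
    and "filtration (space M) F" and "\<And>k. subalgebra M (F k)"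
    and "\<And>k. S k \<in> F k \<rightarrow>\<^sub>M \<S>" and "\<And>k. X k \<in> F k \<rightarrow>\<^sub>M \<X>"
    and "\<And>k. k \<ge> 1 \<Longrightarrow> adapt_event M S k \<in> sets M"
    and "\<And>k A. A \<in> sets \<X> \<Longrightarrow>
           AE \<omega> in M. real_cond_exp M (F k) (indicator {\<omega> \<in> space M. X (k + 1) \<omega> \<in> A}) \<omega>
                      = measure (P (S k \<omega>) (X k \<omega>)) A"
    and "0 \<le> \<rho>" and "\<rho> < 1"
    and "\<And>s x k. s \<in> space \<S> \<Longrightarrow> x \<in> space \<X> \<Longrightarrow>
           tv_dist (kernel_power \<X> (P s) k x) \<pi> \<le> B * \<rho> ^ k"
    and "summable (\<lambda>k. measure M (adapt_event M S (Suc k)) / real (Suc k)) \<or>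
         (\<Sum>j. \<integral>\<^sup>+ \<omega>. inverse (ennreal_of_enat (adapt_time (adapt_event M S) (Suc j) \<omega>)) \<partial>M) < \<infinity>"
    and "\<phi> \<in> borel_measurable \<X>" and "bounded (\<phi> ` space \<X>)"
  shows "AE \<omega> in M. (\<lambda>n. (\<Sum>k = 1..n. \<phi> (X k \<omega>)) / real n) \<longlonglongrightarrow> (\<integral>x. \<phi> x \<partial>\<pi>)"
proof -
  interpret M: prob_space M by fact
  note joint = measurable_kernel_family[OF assms(3,5)]
  obtain b where b: "0 < b" "\<And>x. x \<in> space \<X> \<Longrightarrow> \<bar>\<phi> x\<bar> \<le> b"
    using \<open>bounded (\<phi> ` space \<X>)\<close> unfolding bounded_pos by auto
  interpret ergodic_kernel_family \<X> \<S> \<pi> P B \<rho> b \<phi>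
    by (rule ergodic_kernel_family.intro[OF assms(1-3) joint assms(13-15) assms(17) b])
  note sub = \<open>\<And>k. subalgebra M (F k)\<close>
  note S_F = \<open>\<And>k. S k \<in> F k \<rightarrow>\<^sub>M \<S>\<close> and X_F = \<open>\<And>k. X k \<in> F k \<rightarrow>\<^sub>M \<X>\<close>
  note S_M [measurable] = measurable_from_subalg[OF sub S_F]
  note X_M [measurable] = measurable_from_subalg[OF sub X_F]
  have mono: "subalgebra (F j) (F i)" if "i \<le> j" for i j
    using filtration.sets_F_mono[OF assms(7) that] filtration.space_F[OF assms(7)]
    by (simp add: subalgebra_def)
  define G where "G = 2 * b * B / (1 - \<rho>)"
  \<comment> \<open>The time indices of parameter and state are independent, because mixed pairs
    such as \<open>S k\<close> with \<open>X (Suc k)\<close> occur below.\<close>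
  have g_bound: "\<bar>poisson (S j \<omega>) (X k \<omega>)\<bar> \<le> G" if "\<omega> \<in> space M" for j k \<omega>
    unfolding G_def using that measurable_space[OF S_M] measurable_space[OF X_M]
    by (intro poisson_bound) auto
  have g_meas: "(\<lambda>\<omega>. poisson (S j \<omega>) (X k \<omega>)) \<in> borel_measurable (F m)" if "j \<le> m" "k \<le> m" for j k m
    using measurable_compose[OF measurable_Pair[OF measurable_from_subalg[OF mono[OF that(1)] S_F]
        measurable_from_subalg[OF mono[OF that(2)] X_F]] poisson_measurable] by simp
  have \<phi>_meas: "(\<lambda>\<omega>. \<phi> (X k \<omega>)) \<in> borel_measurable (F m)" if "k \<le> m" for k m
    by (rule measurable_compose[OF measurable_from_subalg[OF mono[OF that] X_F] \<phi>])
  \<comment> \<open>By the Poisson equation this is the one-step average of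
    \<open>poisson (S k \<omega>)\<close> from \<open>X k \<omega>\<close>; the closed form makes
    its measurability and bound immediate.\<close>
  define h where "h k \<omega> = poisson (S k \<omega>) (X k \<omega>) - \<phi> (X k \<omega>) + mean" for k \<omega>
  have h_meas: "h k \<in> borel_measurable (F k)" for k
    unfolding h_def using g_meas[of k k k] \<phi>_meas[of k k] by simp
  have h_bound: "\<bar>h k \<omega>\<bar> \<le> G + b + \<bar>mean\<bar>" if "\<omega> \<in> space M" for k \<omega>
    using g_bound[OF that, of k k] b(2)[of "X k \<omega>"] measurable_space[OF X_M that, of k]
    unfolding h_def by linarith
  have cond: "AE \<omega> in M. real_cond_exp M (F k) (\<lambda>\<omega>. poisson (S k \<omega>) (X (Suc k) \<omega>)) \<omega> = h k \<omega>" for k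
  proof -
    have "AE \<omega> in M. real_cond_exp M (F k) (\<lambda>\<omega>. poisson (S k \<omega>) (X (Suc k) \<omega>)) \<omega>
        = (\<integral>y. poisson (S k \<omega>) y \<partial>P (S k \<omega>) (X k \<omega>))"
      using assms(12)[of _ k]
      by (intro real_cond_exp_kernel[OF assms(6) sub joint S_F X_F X_M _ poisson_measurable poisson_bound]) auto
    then show ?thesis
      using AE_space
    proof eventually_elim
      case (elim \<omega>)
      then show ?case
        using poisson_equation measurable_space[OF S_M] measurable_space[OF X_M] by (simp add: h_def)
    qed
  qed
  \<comment> \<open>The shift by one starts the sums at \<open>X 1\<close>, like the averages in the
    conclusion: \<open>d k\<close> is the martingale difference of the move from time
    \<open>Suc k\<close> to \<open>Suc (Suc k)\<close>.\<close>
  define d where "d k \<omega> = poisson (S (Suc k) \<omega>) (X (Suc (Suc k)) \<omega>) - h (Suc k) \<omega>" for k \<omega>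
  have d_F: "d k \<in> borel_measurable (F (Suc (Suc k)))" for k
    unfolding d_def using g_meas[of "Suc k" "Suc (Suc k)" "Suc (Suc k)"]
      measurable_from_subalg[OF mono h_meas, of "Suc k" "Suc (Suc k)"] by simp
  have d_M: "d k \<in> borel_measurable M" for k
    by (rule measurable_from_subalg[OF sub d_F])
  have d_bound: "\<bar>d k \<omega>\<bar> \<le> 2 * G + b + \<bar>mean\<bar>" if "\<omega> \<in> space M" for k \<omega>
    using g_bound[OF that, of "Suc k" "Suc (Suc k)"] h_bound[OF that, of "Suc k"]
    unfolding d_def by linarith
  have orth: "M.expectation (\<lambda>\<omega>. d j \<omega> * d k \<omega>) = 0" if "j < k" for j k
  proof -
    interpret Fk: finite_measure_subalgebra M "F (Suc k)" by unfold_locales (rule sub)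
    let ?g = "\<lambda>\<omega>. poisson (S (Suc k) \<omega>) (X (Suc (Suc k)) \<omega>)"
    \<comment> \<open>From \<open>j < k\<close> it follows that \<open>Suc (Suc j)\<close> is at
      most \<open>Suc k\<close>, so \<open>d j\<close> is already known when conditioning on
      \<open>F (Suc k)\<close> and can be pulled out.\<close>
    have dj: "d j \<in> borel_measurable (F (Suc k))"
      using that by (intro measurable_from_subalg[OF mono d_F]) simp
    have g_M: "?g \<in> borel_measurable M"
      by (rule measurable_from_subalg[OF sub g_meas[of "Suc k" "Suc (Suc k)" "Suc (Suc k)"]]) auto
    have h_M: "h (Suc k) \<in> borel_measurable M" by (rule measurable_from_subalg[OF sub h_meas])
    note [measurable] = d_M g_M h_M
    obtain \<omega>0 where "\<omega>0 \<in> space M" using M.not_empty by auto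
    then have D: "0 \<le> 2 * G + b + \<bar>mean\<bar>" using d_bound[of \<omega>0 0] by linarith
    have dg_int: "integrable M (\<lambda>\<omega>. d j \<omega> * ?g \<omega>)"
      by (rule M.integrable_const_bound[of _ "(2 * G + b + \<bar>mean\<bar>) * G"])
         (use d_bound g_bound D in \<open>auto simp: abs_mult intro!: mult_mono\<close>)
    have dh_int: "integrable M (\<lambda>\<omega>. d j \<omega> * h (Suc k) \<omega>)"
      by (rule M.integrable_const_bound[of _ "(2 * G + b + \<bar>mean\<bar>) * (G + b + \<bar>mean\<bar>)"])
         (use d_bound h_bound D in \<open>auto simp: abs_mult intro!: mult_mono\<close>)
    have "M.expectation (\<lambda>\<omega>. d j \<omega> * ?g \<omega>)
        = M.expectation (\<lambda>\<omega>. d j \<omega> * real_cond_exp M (F (Suc k)) ?g \<omega>)"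
      by (rule Fk.real_cond_exp_intg(2)[OF dg_int dj g_M, symmetric])
    also have "\<dots> = M.expectation (\<lambda>\<omega>. d j \<omega> * h (Suc k) \<omega>)"
      using cond[of "Suc k"] by (intro integral_cong_AE) (auto elim: AE_mp)
    finally have "M.expectation (\<lambda>\<omega>. d j \<omega> * ?g \<omega>) - M.expectation (\<lambda>\<omega>. d j \<omega> * h (Suc k) \<omega>) = 0"
      by simp
    then show ?thesis
      using dg_int dh_int by (simp add: d_def[of k] right_diff_distrib)
  qed
  have "AE \<omega> in M. (\<lambda>n. (\<Sum>k<n. d k \<omega>) / real n) \<longlonglongrightarrow> 0"
    by (rule M.strong_law_bounded_orthogonal[OF d_M d_bound orth])
  moreover have "AE \<omega> in M. (\<lambda>n. (\<Sum>k<n. indicator (adapt_event M S (Suc k)) \<omega>) / real n) \<longlonglongrightarrow> (0 :: real)"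
    by (rule M.AE_adaptation_rate_tendsto_0[OF assms(11,16)])
  ultimately show ?thesis
    using AE_space
  proof eventually_elim
    case (elim \<omega>)
    define N where "N n = (\<Sum>k<n. indicator (adapt_event M S (Suc k)) \<omega> :: real)" for n
    let ?R = "\<lambda>n. \<Sum>k<n. poisson (S (Suc k) \<omega>) (X (Suc k) \<omega>) - poisson (S (Suc k) \<omega>) (X (Suc (Suc k)) \<omega>)"
    have N_eq: "N n = (\<Sum>k<n. of_bool (S (Suc k) \<omega> \<noteq> S k \<omega>))" for n
      unfolding N_def using elim(3) by (simp add: adapt_event_def indicator_def)
    \<comment> \<open>The telescoping error per step consists of the boundary terms and the
      proportion of adaptations, both of which vanish.\<close>
    have "(\<lambda>n. 2 * G / real n + 2 * G * (N n / real n)) \<longlonglongrightarrow> 0 + 2 * G * 0"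
      unfolding N_def by (intro tendsto_intros lim_const_over_n elim(2))
    then have R_lim: "(\<lambda>n. ?R n / real n) \<longlonglongrightarrow> 0"
    proof (rule Lim_null_comparison[rotated, OF tendsto_eq_rhs])
      show "\<forall>\<^sub>F n in sequentially. norm (?R n / real n) \<le> 2 * G / real n + 2 * G * (N n / real n)"
      proof (rule always_eventually, rule allI)
        fix n
        have "\<bar>?R n\<bar> \<le> 2 * G + 2 * G * N n"
          unfolding N_eq using g_bound[OF elim(3)]
          by (intro abs_sum_poisson_telescope_le[where s = "\<lambda>k. S k \<omega>" and x = "\<lambda>k. X k \<omega>"])
        then have "\<bar>?R n\<bar> / real n \<le> (2 * G + 2 * G * N n) / real n" by (rule divide_right_mono) simp
        then show "norm (?R n / real n) \<le> 2 * G / real n + 2 * G * (N n / real n)"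
          by (simp add: abs_divide add_divide_distrib)
      qed
    qed simp
    have "(\<lambda>n. (\<Sum>k<n. d k \<omega>) / real n + ?R n / real n + mean) \<longlonglongrightarrow> 0 + 0 + mean"
      by (intro tendsto_add elim(1) R_lim tendsto_const)
    then have "(\<lambda>n. (\<Sum>k<n. d k \<omega>) / real n + ?R n / real n + mean) \<longlonglongrightarrow> mean" by simp
    moreover have "\<forall>\<^sub>F n in sequentially. (\<Sum>k<n. d k \<omega>) / real n + ?R n / real n + mean
        = (\<Sum>k = 1..n. \<phi> (X k \<omega>)) / real n"
      using eventually_gt_at_top[of 0]
    proof eventually_elim
      case (elim n)
      \<comment> \<open>Termwise, the two values of \<open>poisson (S (Suc k) \<omega>)\<close>
        cancel and the centred observation at \<open>X (Suc k) \<omega>\<close> remains.\<close>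
      have "(\<Sum>k<n. d k \<omega>) + ?R n = (\<Sum>k<n. \<phi> (X (Suc k) \<omega>) - mean)"
        unfolding sum.distrib[symmetric] by (intro sum.cong) (simp_all add: d_def h_def)
      also have "\<dots> = (\<Sum>k = 1..n. \<phi> (X k \<omega>)) - real n * mean"
        by (simp add: sum_subtractf sum.atLeast1_atMost_eq)
      finally show ?case using elim by (simp add: field_simps)
    qed
    ultimately show ?case unfolding mean_def by (rule Lim_transform_eventually)
  qed
qed

end
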